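(* Let $m\ge2$ and $K>0$, and let $h_+$ be $\frac1K$ times the standard metric of the unit sphere $\mathbb{S}^{2m-1}$. The moduli space $\mathcal{M}_{\mathcal{K}}$ for $(2m-1)$-dimensional Kropina metrics of constant flag curvature $K$ consists of the single point $$(a_1,a_2,\dots,a_m)=(\sqrt K,\sqrt K,\dots,\sqrt K)\in\mathbb{E}^m;$$ i.e. up to Riemannian isometry there is exactly one pair $(h_+,W)$, with $W$ a unit length Killing vector field of $(\mathbb{S}^{2m-1},h_+)$, and it induces all CC-Kropina structures of constant flag curvature $K$ on $\mathbb{S}^{2m-1}$.
   Context: A CC-Kropina structure of constant flag curvature $K$ on $\mathbb{S}^{2m-1}$ is the conic Finsler metric $F(x,y)=\frac{h_+(y,y)}{2h_+(y,W)}$ on $\{h_+(y,W)>0\}$ determined by a globally defined Killing field $W$ of $(\mathbb{S}^{2m-1},h_+)$ with $h_+(W,W)=1$. The isometry group of $(\mathbb{S}^{2m-1},h_+)$ is $O(2m)$. Killing fields $W$ of $(\mathbb{S}^{2m-1},h_+)$ correspond to skew-symmetric matrices $\Omega\in\mathfrak{o}(2m)$ by $(W_p)^t=p^t\Omega$ for $p\in\mathbb{S}^{2m-1}\subset\mathbb{E}^{2m}$ (column vectors), and the push-forward $W\mapsto\phi_*W$ by isometries $\phi$ corresponds to the adjoint action $\Omega\mapsto g\Omega g^{-1}$, $g\in O(2m)$. Every $O(2m)$-orbit in $\mathfrak{o}(2m)$ contains a unique normal form $\tilde\Omega=a_1J\oplus\cdots\oplus a_mJ$ with $J=\begin{pmatrix}0&1\\-1&0\end{pmatrix}$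 and $a_1\ge a_2\ge\cdots\ge a_m\ge0$, and the orbit is identified with the point $(a_1,\dots,a_m)\in\mathbb{E}^m$. The moduli space $\mathcal{M}_{\mathcal{K}}$ is the set of $O(2m)$-orbits of (matrices of) unit length Killing fields of $(\mathbb{S}^{2m-1},h_+)$, described by these points; each orbit corresponds to one conic isometry class of Kropina metrics. *)

theory Defs
  imports "HOL-Analysis.Analysis"
begin

section \<open>Calculus on the unit sphere\<close>

abbreviation usphere :: "'v::euclidean_space set"
  where "usphere \<equiv> sphere 0 1"

definition tangent_space :: "'v::euclidean_space \<Rightarrow> 'v set"
  where "tangent_space p = {u. u \<bullet> p = 0}"

primrec Ck_on :: "nat \<Rightarrow> ('v::euclidean_space \<Rightarrow> 'w::euclidean_space) \<Rightarrow> 'v set \<Rightarrow> bool"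
  where
    "Ck_on 0 f U \<longleftrightarrow> continuous_on U f"
  | "Ck_on (Suc k) f U \<longleftrightarrow>
       (\<forall>x\<in>U. f differentiable (at x)) \<and>
       (\<forall>v. Ck_on k (\<lambda>x. frechet_derivative f (at x) v) U)"

text \<open>A map on an arbitrary set is smooth if it extends smoothly to an open neighbourhood.\<close>

definition smooth_map_on :: "'v::euclidean_space set \<Rightarrow> ('v \<Rightarrow> 'w::euclidean_space) \<Rightarrow> bool"
  where "smooth_map_on S f \<longleftrightarrow>
    (\<exists>U g. open U \<and> S \<subseteq> U \<and> (\<forall>k. Ck_on k g U) \<and> (\<forall>x\<in>S. g x = f x))"

text \<open>The derivative within the sphere is not unique as a linear map on the ambient space, but
  its values on tangent vectors are: there it is the differential of \<open>f\<close>.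
  It is only ever applied to tangent vectors below.\<close>

definition sphere_diff :: "('v::euclidean_space \<Rightarrow> 'v) \<Rightarrow> 'v \<Rightarrow> 'v \<Rightarrow> 'v"
  where "sphere_diff f p u = frechet_derivative f (at p within usphere) u"

definition sphere_diffeo :: "('v::euclidean_space \<Rightarrow> 'v) \<Rightarrow> bool"
  where "sphere_diffeo \<phi> \<longleftrightarrow>
    bij_betw \<phi> usphere usphere \<and> smooth_map_on usphere \<phi> \<and>
    smooth_map_on usphere (the_inv_into usphere \<phi>)"

text \<open>Values of a vector field off the sphere are irrelevant.\<close>

definition sphere_vector_field :: "('v::euclidean_space \<Rightarrow> 'v) \<Rightarrow> bool"
  where "sphere_vector_field W \<longleftrightarrow>
    smooth_map_on usphere W \<and> (\<forall>p\<in>usphere. W p \<in> tangent_space p)"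

definition pushforward :: "('v::euclidean_space \<Rightarrow> 'v) \<Rightarrow> ('v \<Rightarrow> 'v) \<Rightarrow> 'v \<Rightarrow> 'v"
  where "pushforward \<phi> W q =
    (let p = the_inv_into usphere \<phi> q in sphere_diff \<phi> p (W p))"

section \<open>The metric \<open>h\<^sub>+\<close>, its isometries and its Killing fields\<close>

text \<open>The sphere of curvature \<open>K\<close>; the base point is suppressed, since the formula does not
  depend on it.\<close>

definition h_plus :: "real \<Rightarrow> 'v::euclidean_space \<Rightarrow> 'v \<Rightarrow> real"
  where "h_plus K u v = (1 / K) * (u \<bullet> v)"

definition sphere_isometry :: "real \<Rightarrow> ('v::euclidean_space \<Rightarrow> 'v) \<Rightarrow> bool"
  where "sphere_isometry K \<phi> \<longleftrightarrow> sphere_diffeo \<phi> \<and>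
    (\<forall>p\<in>usphere. \<forall>u\<in>tangent_space p. \<forall>v\<in>tangent_space p.
       h_plus K (sphere_diff \<phi> p u) (sphere_diff \<phi> p v) = h_plus K u v)"

text \<open>The Levi-Civita derivative of \<open>W\<close> in the direction \<open>u\<close> at \<open>p\<close>: the tangential part of
  the differential. It is the same for all constant multiples of the round metric.\<close>

definition levi_civita :: "('v::euclidean_space \<Rightarrow> 'v) \<Rightarrow> 'v \<Rightarrow> 'v \<Rightarrow> 'v"
  where "levi_civita W p u = sphere_diff W p u - (sphere_diff W p u \<bullet> p) *\<^sub>R p"

definition killing_field :: "real \<Rightarrow> ('v::euclidean_space \<Rightarrow> 'v) \<Rightarrow> bool"
  where "killing_field K W \<longleftrightarrow> sphere_vector_field W \<and>
    (\<forall>p\<in>usphere. \<forall>u\<in>tangent_space p. \<forall>v\<in>tangent_space p.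
       h_plus K (levi_civita W p u) v + h_plus K u (levi_civita W p v) = 0)"

definition unit_killing_field :: "real \<Rightarrow> ('v::euclidean_space \<Rightarrow> 'v) \<Rightarrow> bool"
  where "unit_killing_field K W \<longleftrightarrow>
    killing_field K W \<and> (\<forall>p\<in>usphere. h_plus K (W p) (W p) = 1)"

section \<open>CC-Kropina structures\<close>

text \<open>A conic Finsler metric on the sphere is represented by its conic domain in the tangent
  bundle together with the function on it (undefined outside the domain).\<close>

type_synonym 'v conic_metric = "('v \<times> 'v) set \<times> ('v \<times> 'v \<Rightarrow> real)"

definition kropina_domain :: "real \<Rightarrow> ('v::euclidean_space \<Rightarrow> 'v) \<Rightarrow> ('v \<times> 'v) set"
  where "kropina_domain K W =
    {(p, y). p \<in> usphere \<and> y \<in> tangent_space p \<and> h_plus K y (W p) > 0}"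

definition kropina_metric :: "real \<Rightarrow> ('v::euclidean_space \<Rightarrow> 'v) \<Rightarrow> 'v conic_metric"
  where "kropina_metric K W =
    (kropina_domain K W,
     restrict (\<lambda>(p, y). h_plus K y y / (2 * h_plus K y (W p))) (kropina_domain K W))"

definition cc_kropina_structures :: "real \<Rightarrow> ('v::euclidean_space) conic_metric set"
  where "cc_kropina_structures K = {kropina_metric K W | W. unit_killing_field K W}"

definition conic_isometric :: "('v::euclidean_space) conic_metric \<Rightarrow> 'v conic_metric \<Rightarrow> bool"
  where "conic_isometric M N \<longleftrightarrow> (\<exists>\<phi>. sphere_diffeo \<phi> \<and>
    (\<forall>p\<in>usphere. \<forall>y\<in>tangent_space p.
       ((p, y) \<in> fst M \<longleftrightarrow> (\<phi> p, sphere_diff \<phi> p y) \<in> fst N) \<and>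
       ((p, y) \<in> fst M \<longrightarrow> snd N (\<phi> p, sphere_diff \<phi> p y) = snd M (p, y))))"

section \<open>Matrices of Killing fields and the moduli space\<close>

text \<open>Euclidean \<open>2m\<close>-space is \<open>real ^ ('m \<times> 2)\<close> with \<open>m = CARD('m)\<close>; the coordinate \<open>(i, r)\<close> is
  the \<open>r\<close>-th one in the \<open>i\<close>-th \<open>2 \<times> 2\<close> block. The order on \<open>'m\<close> gives the order of the blocks.\<close>

type_synonym 'm matrix_2m = "real ^ ('m \<times> 2) ^ ('m \<times> 2)"

definition J :: "real ^ 2 ^ 2"
  where "J = vector [vector [0, 1], vector [-1, 0]]"

definition block_form :: "real ^ 'm::{finite,linorder} \<Rightarrow> 'm matrix_2m"
  where "block_form a = (\<chi> k l. if fst k = fst l then a $ fst k * J $ snd k $ snd l else 0)"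

definition normal_parameters :: "(real ^ 'm::{finite,linorder}) set"
  where "normal_parameters = {a. (\<forall>i j. i \<le> j \<longrightarrow> a $ j \<le> a $ i) \<and> (\<forall>i. 0 \<le> a $ i)}"

definition adjoint_orbit :: "'m::{finite,linorder} matrix_2m \<Rightarrow> 'm matrix_2m set"
  where "adjoint_orbit \<Omega> = {g ** \<Omega> ** matrix_inv g | g. orthogonal_matrix g}"

text \<open>The skew-symmetric matrix of \<open>W\<close>, with the convention \<open>W\<^sub>p\<^sup>t = p\<^sup>t \<Omega>\<close>.\<close>

definition unit_killing_matrices :: "real \<Rightarrow> 'm::{finite,linorder} matrix_2m set"
  where "unit_killing_matrices K =
    {\<Omega>. transpose \<Omega> = - \<Omega> \<and>
         (\<exists>W. unit_killing_field K W \<and> (\<forall>p\<in>usphere. W p = p v* \<Omega>))}"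

definition moduli_space :: "real \<Rightarrow> 'm::{finite,linorder} matrix_2m set set"
  where "moduli_space K = adjoint_orbit ` unit_killing_matrices K"

definition orbit_point :: "'m matrix_2m set \<Rightarrow> real ^ 'm::{finite,linorder}"
  where "orbit_point Orb = (THE a. a \<in> normal_parameters \<and> block_form a \<in> Orb)"

end

theory Submission
  imports Defs
begin

text \<open>If \<open>\<gamma>\<close> is a great circle and \<open>W\<close> a Killing field, then \<open>W \<circ> \<gamma> \<bullet> \<gamma>'\<close> is constant. Evaluated at
  two points \<open>p\<close>, \<open>q\<close> of \<open>\<gamma>\<close> this says \<open>W p \<bullet> q = - (p \<bullet> W q)\<close>, which forces \<open>W\<close> to be the
  restriction of a skew-symmetric linear map \<open>\<Omega>\<close>. Unit length means \<open>\<Omega>\<^sup>2 = -K\<close>, so that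
  \<open>\<Omega> / sqrt K\<close> is an orthogonal complex structure; splitting off the planes spanned by \<open>x\<close> and
  \<open>\<Omega> x\<close> one after the other brings it to normal form by an orthogonal change of basis.\<close>

section \<open>Differentials on the sphere\<close>

lemma great_circle_in_sphere:
  fixes p e :: "'v::euclidean_space"
  assumes "norm p = 1" "norm e = 1" "e \<bullet> p = 0"
  shows "cos t *\<^sub>R p + sin t *\<^sub>R e \<in> usphere"
proof -
  have "(norm (cos t *\<^sub>R p + sin t *\<^sub>R e))\<^sup>2 = 1"
    using assms sin_cos_squared_add2[of t] inner_commute[of p e] unfolding power2_norm_eq_inner
    by (simp add: inner_add_left inner_add_right norm_eq_1 power2_eq_square)
  then show ?thesis using power2_eq_imp_eq[of "norm _" 1] by simp
qed

text \<open>The great circle never leaves the sphere, so the chain rule applies to a derivative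
  taken within the sphere, with no extension of \<open>f\<close> involved.\<close>

lemma great_circle_chain:
  fixes p e :: "'v::euclidean_space" and f :: "'v \<Rightarrow> 'w::euclidean_space"
  assumes "norm p = 1" "norm e = 1" "e \<bullet> p = 0"
    and "(f has_derivative D) (at (cos t *\<^sub>R p + sin t *\<^sub>R e) within usphere)"
  shows "((\<lambda>t. f (cos t *\<^sub>R p + sin t *\<^sub>R e)) has_vector_derivative
           D (cos t *\<^sub>R e - sin t *\<^sub>R p)) (at t)"
proof -
  let ?g = "\<lambda>t. cos t *\<^sub>R p + sin t *\<^sub>R e"
  let ?g' = "cos t *\<^sub>R e - sin t *\<^sub>R p"
  have g: "(?g has_vector_derivative ?g') (at t within UNIV)"
    by (auto intro!: derivative_eq_intros simp: algebra_simps)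
  have "?g ` UNIV \<subseteq> usphere"
    using great_circle_in_sphere[OF assms(1-3)] by blast
  then have "(f has_derivative D) (at (?g t) within ?g ` UNIV)"
    using assms(4) has_derivative_subset by blast
  from diff_chain_within[OF g[unfolded has_vector_derivative_def] this]
  have "((f \<circ> ?g) has_derivative (\<lambda>x. D (x *\<^sub>R ?g'))) (at t)"
    by (simp add: o_def)
  moreover have "D (x *\<^sub>R ?g') = x *\<^sub>R D ?g'" for x
    using assms(4) by (simp add: has_derivative_bounded_linear bounded_linear.linear linear_cmul)
  ultimately show ?thesis by (simp add: has_vector_derivative_def o_def)
qed

text \<open>Any two derivatives within the sphere agree on tangent vectors: a unit tangent vector is
  the velocity of a great circle, and the derivative along a curve in one real variable is unique.
  Hence the choice hidden in \<open>frechet_derivative\<close> is harmless.\<close>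

lemma sphere_diff_eq:
  fixes f :: "'v::euclidean_space \<Rightarrow> 'v"
  assumes f: "(f has_derivative D) (at p within usphere)"
    and p: "p \<in> usphere" and u: "u \<in> tangent_space p"
  shows "sphere_diff f p u = D u"
proof -
  define D' where "D' = frechet_derivative f (at p within usphere)"
  have D': "(f has_derivative D') (at p within usphere)"
    unfolding D'_def using f differentiableI frechet_derivative_works by blast
  have lin: "linear D" "linear D'"
    using f D' by (auto intro: has_derivative_bounded_linear bounded_linear.linear)
  have "D' u = D u"
  proof (cases "u = 0")
    case True
    then show ?thesis using lin by (simp add: linear_0)
  next
    case False
    define e where "e = u /\<^sub>R norm u"
    have e: "norm e = 1" "e \<bullet> p = 0" and ue: "u = norm u *\<^sub>R e"
      using False u by (auto simp: e_def tangent_space_def)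
    have p1: "norm p = 1" using p by simp
    have "D e = D' e"
      \<comment> \<open>At parameter \<open>0\<close> the circle is at \<open>p\<close> with
        velocity \<open>e\<close>.\<close>
      using vector_derivative_unique_at[OF great_circle_chain[OF p1 e, of f D 0]
          great_circle_chain[OF p1 e, of f D' 0]] f D' by simp
    then show ?thesis using lin ue by (metis linear_cmul)
  qed
  then show ?thesis by (simp add: sphere_diff_def D'_def)
qed

lemma sphere_diff_linear:
  fixes f :: "'v::euclidean_space \<Rightarrow> 'v"
  assumes "linear f" "p \<in> usphere" "u \<in> tangent_space p"
  shows "sphere_diff f p u = f u"
  using assms by (intro sphere_diff_eq)
    (auto intro: linear_imp_has_derivative)

text \<open>The derivative at \<open>p\<close> of a smooth extension, restricted to the sphere,
  serves as a derivative of \<open>W\<close> there.\<close>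

lemma smooth_map_on_sphere_has_derivative:
  fixes W :: "'v::euclidean_space \<Rightarrow> 'v"
  assumes "smooth_map_on usphere W" "p \<in> usphere"
  shows "(W has_derivative sphere_diff W p) (at p within usphere)"
proof -
  obtain U g where g: "open U" "usphere \<subseteq> U" "\<forall>k. Ck_on k g U" "\<forall>x\<in>usphere. g x = W x"
    using assms(1) unfolding smooth_map_on_def by blast
  have "Ck_on (Suc 0) g U" using g(3) by blast
  then have "g differentiable (at p)" using g(2) assms(2) by auto
  then have "g differentiable (at p within usphere)"
    using differentiable_at_withinI by blast
  then obtain D where "(g has_derivative D) (at p within usphere)"
    unfolding differentiable_def by blast
  then have "(W has_derivative D) (at p within usphere)"
    by (rule has_derivative_transform[rotated 2]) (use g assms in auto)
  then have "W differentiable (at p within usphere)"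
    unfolding differentiable_def by blast
  then have "(W has_derivative frechet_derivative W (at p within usphere)) (at p within usphere)"
    by (simp add: frechet_derivative_works)
  moreover have "frechet_derivative W (at p within usphere) = sphere_diff W p"
    by (rule ext) (simp add: sphere_diff_def)
  ultimately show ?thesis by simp
qed

section \<open>Smoothness of linear maps\<close>

lemma Ck_on_const: "Ck_on k (\<lambda>x. c) U"
proof (induction k arbitrary: c)
  case (Suc k)
  then show ?case by (simp add: frechet_derivative_const)
qed simp

text \<open>A directional derivative of a linear map is constant in the base point, so the higher
  levels reduce to constants.\<close>

lemma Ck_on_linear:
  assumes "linear f"
  shows "Ck_on k f U"
proof (cases k)
  case 0
  then show ?thesis using assms by (simp add: linear_continuous_on linear_linear)
next
  case (Suc n)
  have d: "(f has_derivative f) (at x)" for x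
    using assms by (rule linear_imp_has_derivative)
  then have "frechet_derivative f (at x) = f" for x
    using frechet_derivative_at by metis
  then show ?thesis
    using d Suc by (auto simp: Ck_on_const differentiable_def)
qed

lemma smooth_map_on_linear:
  assumes "linear f"
  shows "smooth_map_on S f"
  unfolding smooth_map_on_def using Ck_on_linear[OF assms]
  by (intro exI[of _ UNIV] exI[of _ f]) auto

section \<open>Killing fields are linear\<close>

text \<open>This is the Killing equation with both arguments equal to \<open>u\<close>; the normal
  correction in \<open>levi_civita\<close> is a multiple of \<open>p\<close> and vanishes against
  \<open>u\<close>.\<close>

lemma killing_field_diff:
  assumes "killing_field K W" "0 < K" "p \<in> usphere" "u \<in> tangent_space p"
  shows "sphere_diff W p u \<bullet> u = 0"
proof -
  have "h_plus K (levi_civita W p u) u + h_plus K u (levi_civita W p u) = 0"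
    using assms unfolding killing_field_def by blast
  moreover have "p \<bullet> u = 0" using assms(4) by (simp add: tangent_space_def inner_commute)
  ultimately show ?thesis
    using assms(2) by (simp add: h_plus_def levi_civita_def inner_diff_left inner_diff_right
        inner_commute)
qed

text \<open>Along a great circle \<open>g\<close> with velocity \<open>g'\<close>, the derivative of
  \<open>W (g t) \<bullet> g' t\<close> has two terms. The one with the differential of
  \<open>W\<close> vanishes by the Killing equation; the other contains g'' = -g, which is
  orthogonal to the tangent vector \<open>W (g t)\<close>.\<close>

lemma killing_field_const_on_great_circle:
  fixes W :: "'v::euclidean_space \<Rightarrow> 'v"
  assumes W: "killing_field K W" and "0 < K"
    and pe: "norm p = 1" "norm e = 1" "e \<bullet> p = 0"
  shows "W (cos t *\<^sub>R p + sin t *\<^sub>R e) \<bullet> (cos t *\<^sub>R e - sin t *\<^sub>R p) = W p \<bullet> e"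
proof -
  define g where "g = (\<lambda>t. cos t *\<^sub>R p + sin t *\<^sub>R e)"
  define g' where "g' = (\<lambda>t. cos t *\<^sub>R e - sin t *\<^sub>R p)"
  have gs: "g t \<in> usphere" for t
    unfolding g_def by (rule great_circle_in_sphere[OF pe])
  have g't: "g' t \<in> tangent_space (g t)" for t
    using pe inner_commute[of p e]
    by (simp add: g_def g'_def tangent_space_def inner_diff_left inner_add_right norm_eq_1)
  have sm: "smooth_map_on usphere W" and tan: "\<And>t. W (g t) \<bullet> g t = 0"
    using W gs by (auto simp: killing_field_def sphere_vector_field_def tangent_space_def)
  have dg': "(g' has_vector_derivative - g t) (at t)" for t
    unfolding g_def g'_def by (auto intro!: derivative_eq_intros simp: algebra_simps)
  have dW: "((\<lambda>t. W (g t)) has_vector_derivative sphere_diff W (g t) (g' t)) (at t)" for t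
    unfolding g_def g'_def
    by (rule great_circle_chain[OF pe smooth_map_on_sphere_has_derivative[OF sm
            great_circle_in_sphere[OF pe]]])
  have "((\<lambda>t. W (g t) \<bullet> g' t) has_vector_derivative
      (W (g t) \<bullet> (- g t) + sphere_diff W (g t) (g' t) \<bullet> g' t)) (at t)" for t
    by (rule bounded_bilinear.has_vector_derivative[OF bounded_bilinear_inner dW dg'])
  then have "((\<lambda>t. W (g t) \<bullet> g' t) has_vector_derivative 0) (at t within UNIV)" for t
    using killing_field_diff[OF W \<open>0 < K\<close> gs g't] tan
    by (metis add.right_neutral inner_minus_right neg_0_equal_iff_equal)
  then obtain c where "\<And>t. W (g t) \<bullet> g' t = c"
    using has_vector_derivative_zero_constant[of UNIV "\<lambda>t. W (g t) \<bullet> g' t"] by auto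
  then have "W (g t) \<bullet> g' t = W (g 0) \<bullet> g' 0" by simp
  then show ?thesis by (simp add: g_def g'_def)
qed

lemma killing_field_skew:
  fixes W :: "'v::euclidean_space \<Rightarrow> 'v"
  assumes W: "killing_field K W" and "0 < K" and p: "p \<in> usphere" and q: "q \<in> usphere"
  shows "W p \<bullet> q = - (p \<bullet> W q)"
proof -
  have tan: "W p \<bullet> p = 0" "W q \<bullet> q = 0"
    using W p q by (auto simp: killing_field_def sphere_vector_field_def tangent_space_def)
  have n: "norm p = 1" "norm q = 1" using p q by auto
  define r where "r = q - (q \<bullet> p) *\<^sub>R p"
  define s where "s = norm r"
  have rp: "r \<bullet> p = 0" using n by (simp add: r_def inner_diff_left norm_eq_1)
  show ?thesis
  proof (cases "r = 0")
    \<comment> \<open>Here q is p or -p, so no great circle is singled out; both sides vanish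
      because \<open>W\<close> is tangent.\<close>
    case True
    then have qp: "q = (q \<bullet> p) *\<^sub>R p" by (simp add: r_def)
    then have c: "q \<bullet> p \<noteq> 0" using n by auto
    have "W p \<bullet> q = 0" using qp tan by (metis inner_scaleR_right mult_zero_right)
    moreover have "p = (1 / (q \<bullet> p)) *\<^sub>R q" using qp c
      by (metis divide_self_if scaleR_one scaleR_scaleR times_divide_eq_left mult_1)
    then have "p \<bullet> W q = 0" using tan by (metis inner_commute inner_scaleR_left mult_zero_right)
    ultimately show ?thesis by simp
  next
    case False
    define e where "e = r /\<^sub>R s"
    have s0: "s > 0" using False by (simp add: s_def)
    have e: "norm e = 1" "e \<bullet> p = 0" using False rp by (auto simp: e_def s_def)
    have qe: "q = (q \<bullet> p) *\<^sub>R p + s *\<^sub>R e" using s0 by (simp add: e_def r_def)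
    \<comment> \<open>Pythagoras puts the coordinates of \<open>q\<close> with respect to
      \<open>p\<close> and \<open>e\<close> on the unit circle, which yields the angle
      \<open>t\<close>.\<close>
    have "q \<bullet> q = (q \<bullet> p)\<^sup>2 + s\<^sup>2"
      using n e by (subst (1 2) qe) (simp add: inner_add_left inner_add_right inner_commute
          norm_eq_1 power2_eq_square)
    then have "(q \<bullet> p)\<^sup>2 + s\<^sup>2 = 1" using n by (simp add: norm_eq_1)
    then obtain t where t: "q \<bullet> p = cos t" "s = sin t"
      using sincos_total_2pi by metis
    have qt: "q = cos t *\<^sub>R p + sin t *\<^sub>R e" using qe t by simp
    have "W q \<bullet> (cos t *\<^sub>R e - sin t *\<^sub>R p) = W p \<bullet> e"
      using killing_field_const_on_great_circle[OF W \<open>0 < K\<close> n(1) e, of t] qt by simp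
    \<comment> \<open>Multiplying the conservation law by \<open>sin t\<close> expresses both
      directions through \<open>p\<close> and \<open>q\<close> alone; tangency at \<open>p\<close>
      and \<open>q\<close> then removes the terms containing \<open>cos t\<close>.\<close>
    moreover have "sin t *\<^sub>R (cos t *\<^sub>R e - sin t *\<^sub>R p) = cos t *\<^sub>R q - p"
    proof -
      have "cos t * cos t = 1 - sin t * sin t"
        using sin_cos_squared_add3[of t] by linarith
      then show ?thesis
        by (simp add: qt scaleR_right_diff_distrib scaleR_left_diff_distrib scaleR_right_distrib
            mult.commute)
    qed
    moreover have "sin t *\<^sub>R e = q - cos t *\<^sub>R p" using qt by simp
    ultimately have "W q \<bullet> (cos t *\<^sub>R q - p) = W p \<bullet> (q - cos t *\<^sub>R p)"
      by (metis inner_scaleR_right)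
    then show ?thesis using tan by (simp add: inner_diff_right inner_commute)
  qed
qed

lemma matrix_vector_mult_minus_left:
  fixes A :: "real ^ 'n ^ 'm"
  shows "(- A) *v x = - (A *v x)"
  by (simp add: vec_eq_iff matrix_vector_mult_def sum_negf)

lemma matrix_vector_mult_minus_right:
  fixes A :: "real ^ 'n ^ 'm"
  shows "A *v (- x) = - (A *v x)"
  by (simp add: vec_eq_iff matrix_vector_mult_def sum_negf)

lemma vector_matrix_skew:
  fixes \<Omega> :: "real ^ 'n ^ 'n"
  assumes "transpose \<Omega> = - \<Omega>"
  shows "x v* \<Omega> = - (\<Omega> *v x)"
  using assms by (metis matrix_vector_mult_minus_left transpose_matrix_vector)

text \<open>By \<open>killing_field_skew\<close> each coordinate of \<open>W p\<close> is minus the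
  inner product of \<open>p\<close> with a fixed vector, so linearity in \<open>p\<close> comes for
  free.\<close>

lemma killing_field_matrix:
  fixes W :: "real ^ 'n \<Rightarrow> real ^ 'n"
  assumes "killing_field K W" "0 < K"
  obtains \<Omega> :: "real ^ 'n ^ 'n"
  where "transpose \<Omega> = - \<Omega>" "\<And>p. p \<in> usphere \<Longrightarrow> W p = p v* \<Omega>"
proof
  \<comment> \<open>In the row convention \<open>p v* \<Omega>\<close>, row \<open>l\<close> is the
    value at the basis vector \<open>axis l 1\<close>.\<close>
  define \<Omega> :: "real ^ 'n ^ 'n" where "\<Omega> = (\<chi> l. W (axis l 1))"
  have skew: "W p $ k = - (p \<bullet> W (axis k 1))" if "p \<in> usphere" for p k
    using killing_field_skew[OF assms that, of "axis k 1"] by (simp add: inner_axis)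
  have \<Omega>: "\<Omega> $ l $ k = - (\<Omega> $ k $ l)" for l k
    using skew[of "axis l 1" k] by (simp add: \<Omega>_def inner_axis')
  have "transpose \<Omega> $ k $ l = (- \<Omega>) $ k $ l" for k l
    using \<Omega>[of l k] by (simp add: transpose_def)
  then show "transpose \<Omega> = - \<Omega>" by (simp add: vec_eq_iff)
  have "W p $ k = (p v* \<Omega>) $ k" if "p \<in> usphere" for p k
  proof -
    have "W p $ k = - (p \<bullet> \<Omega> $ k)" using skew[OF that] by (simp add: \<Omega>_def)
    also have "\<dots> = (\<Sum>l\<in>UNIV. - (\<Omega> $ k $ l) * p $ l)"
      by (simp add: inner_vec_def sum_negf mult.commute)
    also have "\<dots> = (p v* \<Omega>) $ k"
      unfolding vector_matrix_mult_def \<Omega>[of _ k, symmetric] by (simp add: mult.commute)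
    finally show ?thesis .
  qed
  then show "W p = p v* \<Omega>" if "p \<in> usphere" for p
    using that by (simp add: vec_eq_iff)
qed

text \<open>Unit length for \<open>h_plus K\<close> is Euclidean squared length \<open>K\<close>.
  Homogeneity carries this from the sphere to all vectors, and polarization from squares to inner
  products.\<close>

lemma unit_killing_field_matrix:
  fixes W :: "real ^ 'n \<Rightarrow> real ^ 'n"
  assumes W: "unit_killing_field K W" and K: "0 < K"
    and \<Omega>: "transpose \<Omega> = - \<Omega>" "\<And>p. p \<in> usphere \<Longrightarrow> W p = p v* \<Omega>"
  shows "(\<Omega> *v x) \<bullet> (\<Omega> *v y) = K * (x \<bullet> y)"
proof -
  have WO: "W p = - (\<Omega> *v p)" if "p \<in> usphere" for p
    using \<Omega>(2)[OF that] vector_matrix_skew[OF \<Omega>(1)] by simp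
  have sq: "(\<Omega> *v x) \<bullet> (\<Omega> *v x) = K * (x \<bullet> x)" for x
  proof (cases "x = 0")
    case False
    define p where "p = x /\<^sub>R norm x"
    have p: "p \<in> usphere" and x: "x = norm x *\<^sub>R p" using False by (auto simp: p_def)
    have "h_plus K (W p) (W p) = 1" using W p by (auto simp: unit_killing_field_def)
    then have "(\<Omega> *v p) \<bullet> (\<Omega> *v p) = K" using K WO[OF p] by (simp add: h_plus_def)
    moreover have "x \<bullet> x = norm x * norm x" by (simp add: dot_square_norm power2_eq_square)
    ultimately show ?thesis
      by (subst (1 2) x) (simp add: matrix_vector_mult_scaleR)
  qed simp
  have "(\<Omega> *v (x + y)) \<bullet> (\<Omega> *v (x + y)) = K * ((x + y) \<bullet> (x + y))" by (rule sq)
  then show ?thesis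
    using sq[of x] sq[of y]
    by (simp add: matrix_vector_right_distrib inner_add_left inner_add_right inner_commute
        algebra_simps)
qed

text \<open>Converse direction: a linear map is its own differential, so the Killing equation is
  just skewness restricted to tangent vectors.\<close>

lemma unit_killing_field_linear:
  fixes f :: "'v::euclidean_space \<Rightarrow> 'v"
  assumes f: "linear f" and skew: "\<And>x y. f x \<bullet> y = - (x \<bullet> f y)"
    and unit: "\<And>x. f x \<bullet> f x = K * (x \<bullet> x)" and K: "0 < K"
  shows "unit_killing_field K f"
proof -
  have "f p \<bullet> p = 0" for p using skew[of p p] by (simp add: inner_commute)
  moreover have "h_plus K (levi_civita f p u) v + h_plus K u (levi_civita f p v) = 0"
    if "p \<in> usphere" "u \<in> tangent_space p" "v \<in> tangent_space p" for p u v
  proof -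
    have "u \<bullet> p = 0" "p \<bullet> v = 0" using that by (auto simp: tangent_space_def inner_commute)
    then show ?thesis using that skew[of u v]
      by (simp add: h_plus_def levi_civita_def sphere_diff_linear[OF f] inner_diff_left
          inner_diff_right flip: distrib_left)
  qed
  moreover have "h_plus K (f p) (f p) = 1" if "p \<in> usphere" for p
    using that K by (simp add: h_plus_def unit norm_eq_1)
  ultimately show ?thesis
    by (simp add: unit_killing_field_def killing_field_def sphere_vector_field_def
        tangent_space_def smooth_map_on_linear[OF f])
qed

section \<open>Normal forms\<close>

text \<open>\<open>B\<close> is an orthogonal complex structure and the \<open>v i\<close> are
  orthonormal for the associated Hermitian form. They are chosen one at a time, each orthogonal to
  all earlier vectors and to their images under \<open>B\<close>.\<close>

lemma complex_orthonormal_family: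
  fixes B :: "'v::euclidean_space \<Rightarrow> 'v" and S :: "'i set"
  assumes skew: "\<And>x y. B x \<bullet> y = - (x \<bullet> B y)" and iso: "\<And>x y. B x \<bullet> B y = x \<bullet> y"
    and "finite S" and "2 * card S \<le> DIM('v)"
  shows "\<exists>v. \<forall>i\<in>S. \<forall>j\<in>S. v i \<bullet> v j = (if i = j then 1 else 0) \<and> v i \<bullet> B (v j) = 0"
  using \<open>finite S\<close> \<open>2 * card S \<le> DIM('v)\<close>
proof (induction S rule: finite_induct)
  case (insert k S)
  then obtain v where v: "\<forall>i\<in>S. \<forall>j\<in>S. v i \<bullet> v j = (if i = j then 1 else 0) \<and> v i \<bullet> B (v j) = 0"
    by auto
  define T where "T = v ` S \<union> (\<lambda>i. B (v i)) ` S"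
  have "card T \<le> 2 * card S"
    unfolding T_def using card_image_le[OF insert.hyps(1)]
    by (smt (verit) card_Un_le le_trans add_mono mult_2)
  \<comment> \<open>Strict, because the bound for \<open>insert k S\<close> leaves at least two
    dimensions beyond those counted for \<open>S\<close>.\<close>
  then have "dim T < DIM('v)"
    using dim_le_card'[of T] insert by (simp add: T_def)
  then obtain a where a: "a \<noteq> 0" "span T \<subseteq> {x. a \<bullet> x = 0}"
    using lowdim_subset_hyperplane by blast
  define x where "x = a /\<^sub>R norm a"
  have "a \<bullet> y = 0" if "y \<in> T" for y using a(2) span_base[OF that] by auto
  then have xT: "x \<bullet> y = 0" if "y \<in> T" for y using that by (simp add: x_def)
  have x1: "x \<bullet> x = 1" using a(1) unfolding norm_eq_1[symmetric] by (simp add: x_def)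
  have xv: "x \<bullet> v i = 0" "v i \<bullet> x = 0" "x \<bullet> B (v i) = 0" "v i \<bullet> B x = 0" if "i \<in> S" for i
  proof -
    show "x \<bullet> v i = 0" "x \<bullet> B (v i) = 0" using xT that by (auto simp: T_def)
    then show "v i \<bullet> x = 0" "v i \<bullet> B x = 0"
      using skew[of "v i" x] by (auto simp: inner_commute)
  qed
  \<comment> \<open>By skewness this number equals its own negative.\<close>
  have xx: "x \<bullet> B x = 0" using skew[of x x] by (simp add: inner_commute)
  show ?case
    by (rule exI[of _ "v(k := x)"]) (use insert.hyps v xv x1 xx in auto)
qed auto

lemma orthogonal_matrix_rows_inner:
  fixes g :: "real ^ 'n ^ 'n"
  assumes "\<And>k l. g $ k \<bullet> g $ l = (if k = l then 1 else 0)"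
  shows "orthogonal_matrix g"
proof -
  have "g ** transpose g = mat 1"
    using assms by (simp add: vec_eq_iff matrix_matrix_mult_def transpose_def mat_def inner_vec_def)
  then show ?thesis
    by (simp add: orthogonal_matrix matrix_left_right_inverse)
qed

text \<open>\<open>matrix_inv\<close> chooses some two-sided inverse; uniqueness of inverses
  identifies it with the transpose, so orbits can be handled with transposes only.\<close>

lemma orthogonal_matrix_inv_transpose:
  fixes g :: "real ^ 'n ^ 'n"
  assumes "orthogonal_matrix g"
  shows "matrix_inv g = transpose g"
proof -
  have "g ** matrix_inv g = mat 1 \<and> matrix_inv g ** g = mat 1"
    unfolding matrix_inv_def
    by (rule someI[of _ "transpose g"]) (use assms in \<open>simp add: orthogonal_matrix_def\<close>)
  then show ?thesis
    by (metis assms matrix_mul_assoc matrix_mul_lid matrix_mul_rid orthogonal_matrix_def)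
qed

text \<open>Conjugation is read as a change of basis: the entries are the values of the bilinear
  form of \<Omega> on the rows of \<open>g\<close>.\<close>

lemma conjugate_component:
  fixes g \<Omega> :: "real ^ 'n ^ 'n"
  shows "(g ** \<Omega> ** transpose g) $ k $ l = g $ k \<bullet> (\<Omega> *v g $ l)"
proof -
  have "(g ** \<Omega> ** transpose g) $ k $ l = (g ** (\<Omega> ** transpose g)) $ k $ l"
    by (simp add: matrix_mul_assoc)
  then show ?thesis
    by (simp add: matrix_matrix_mult_def matrix_vector_mult_def inner_vec_def transpose_def)
qed

lemma J_simps [simp]: "J $ 1 $ 1 = 0" "J $ 1 $ 2 = 1" "J $ 2 $ 1 = -1" "J $ 2 $ 2 = 0"
  by (simp_all add: J_def)

lemma conjugate_to_block_form:
  fixes \<Omega> :: "'m::{finite,linorder} matrix_2m"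
  assumes skew: "transpose \<Omega> = - \<Omega>" and K: "0 < K"
    and iso: "\<And>x y. (\<Omega> *v x) \<bullet> (\<Omega> *v y) = K * (x \<bullet> y)"
  obtains g where "orthogonal_matrix g"
    "g ** \<Omega> ** transpose g = block_form (\<chi> i. sqrt K)"
proof -
  \<comment> \<open>Dividing by \<open>sqrt K\<close> makes the map isometric while keeping it
    skew.\<close>
  define B where "B x = \<Omega> *v x /\<^sub>R sqrt K" for x
  have OB: "\<Omega> *v x = sqrt K *\<^sub>R B x" for x using K by (simp add: B_def)
  have O: "(\<Omega> *v x) \<bullet> y = - (x \<bullet> (\<Omega> *v y))" for x y
    using vector_matrix_skew[OF skew, of x] dot_lmul_matrix[of x \<Omega> y] by simp
  have B: "B x \<bullet> y = - (x \<bullet> B y)" "B x \<bullet> B y = x \<bullet> y" for x y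
    using O[of x y] iso[of x y] K by (simp_all add: B_def field_simps)
  \<comment> \<open>The bound is an equality, so the \<open>v i\<close> and their images fill all
    rows of a square matrix.\<close>
  have "2 * card (UNIV :: 'm set) \<le> DIM(real ^ ('m \<times> 2))" by simp
  from complex_orthonormal_family[of B, OF B finite_class.finite_UNIV this]
  obtain v :: "'m \<Rightarrow> real ^ ('m \<times> 2)"
    where v: "\<And>i j. v i \<bullet> v j = (if i = j then 1 else 0)" "\<And>i j. v i \<bullet> B (v j) = 0"
    by auto
  have v': "B (v i) \<bullet> v j = 0" for i j using v(2) by (simp add: inner_commute)
  \<comment> \<open>Since \<open>J\<close> has entry \<open>1\<close> at \<open>(1, 2)\<close>, the vector \<open>B (v i)\<close> comes first.\<close>
  define g :: "'m matrix_2m" where "g = (\<chi> k. if snd k = 1 then B (v (fst k)) else v (fst k))"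
  have "g $ k \<bullet> g $ l = (if k = l then 1 else 0)" for k l
    using exhaust_2[of "snd k"] exhaust_2[of "snd l"]
    by (auto simp: g_def v v' B(2) prod_eq_iff)
  then have g: "orthogonal_matrix g" by (rule orthogonal_matrix_rows_inner)
  have BB: "x \<bullet> B (B y) = - (x \<bullet> y)" for x y
    using B(1)[of x "B y"] B(2)[of x y] by simp
  have "(g ** \<Omega> ** transpose g) $ k $ l = block_form (\<chi> i. sqrt K) $ k $ l" for k l
    using exhaust_2[of "snd k"] exhaust_2[of "snd l"]
    by (auto simp: conjugate_component g_def OB v v' B(2) BB block_form_def)
  then have "g ** \<Omega> ** transpose g = block_form (\<chi> i. sqrt K)"
    by (simp add: vec_eq_iff)
  with g that show thesis by blast
qed

section \<open>The model matrix and its Killing field\<close>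

lemma transpose_block_form: "transpose (block_form a) = - block_form a"
proof -
  have "transpose (block_form a) $ k $ l = (- block_form a) $ k $ l" for k l
    using exhaust_2[of "snd k"] exhaust_2[of "snd l"]
    by (auto simp: transpose_def block_form_def)
  then show ?thesis by (simp add: vec_eq_iff)
qed

lemma block_form_mult_vec:
  fixes a :: "real ^ 'm::{finite,linorder}"
  shows "(block_form a *v x) $ (i, 1) = a $ i * x $ (i, 2)"
    and "(block_form a *v x) $ (i, 2) = - (a $ i * x $ (i, 1))"
proof -
  \<comment> \<open>Splitting the sum over index pairs into blocks leaves only block
    \<open>i\<close>.\<close>
  have "(block_form a *v x) $ (i, r) = (\<Sum>j\<in>UNIV. \<Sum>s\<in>UNIV. block_form a $ (i, r) $ (j, s) * x $ (j, s))" for r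
    unfolding matrix_vector_mult_def
    by (simp add: sum.cartesian_product flip: UNIV_Times_UNIV)
  also have "\<dots> r = (\<Sum>j\<in>UNIV. if i = j then a $ i * (J $ r $ 1 * x $ (i, 1) + J $ r $ 2 * x $ (i, 2)) else 0)" for r
    by (rule sum.cong) (auto simp: block_form_def sum_2 algebra_simps)
  finally have "(block_form a *v x) $ (i, r) = a $ i * (J $ r $ 1 * x $ (i, 1) + J $ r $ 2 * x $ (i, 2))" for r
    by simp
  then show "(block_form a *v x) $ (i, 1) = a $ i * x $ (i, 2)"
    and "(block_form a *v x) $ (i, 2) = - (a $ i * x $ (i, 1))"
    by simp_all
qed

text \<open>This identity serves twice: it gives the model field its unit length, and, being
  invariant under conjugation, it determines the parameters of the orbit.\<close>

lemma block_form_square: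
  "block_form (\<chi> i. c) *v (block_form (\<chi> i::'m::{finite,linorder}. c) *v x) = - (c\<^sup>2 *\<^sub>R x)"
proof -
  have "(block_form (\<chi> i. c) *v (block_form (\<chi> i. c) *v x)) $ (i, r) = (- (c\<^sup>2 *\<^sub>R x)) $ (i, r)" for i :: 'm and r
    using exhaust_2[of r] by (auto simp: block_form_mult_vec power2_eq_square)
  then show ?thesis by (simp add: vec_eq_iff)
qed

lemma block_form_unit_killing_field:
  fixes K :: real
  assumes K: "0 < K"
  shows "unit_killing_field K (\<lambda>p. p v* block_form (\<chi> i::'m::{finite,linorder}. sqrt K))"
proof -
  let ?Q = "block_form (\<chi> i::'m. sqrt K)"
  let ?f = "\<lambda>p. p v* ?Q"
  have f: "?f = (\<lambda>p. - (?Q *v p))"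
    using vector_matrix_skew[OF transpose_block_form] by blast
  have skew: "?f x \<bullet> y = - (x \<bullet> ?f y)" for x y
    using dot_lmul_matrix[of x ?Q y] fun_cong[OF f, of y] by simp
  have ff: "?f (?f x) = - (K *\<^sub>R x)" for x
    using block_form_square[of "sqrt K" x] K
    by (simp add: fun_cong[OF f] matrix_vector_mult_minus_right)
  show ?thesis
  proof (rule unit_killing_field_linear)
    show "linear ?f" unfolding f
      by (intro linear_compose_neg matrix_vector_mul_linear)
    \<comment> \<open>Skewness moves one factor across, turning the squared length into -x \<bullet>
      f (f x).\<close>
    show "?f x \<bullet> ?f x = K * (x \<bullet> x)" for x
      using skew[of x "?f x"] ff[of x] by simp
  qed (use skew K in auto)
qed

section \<open>Orbits and isometries\<close>

lemma mem_adjoint_orbit: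
  "\<Psi> \<in> adjoint_orbit \<Omega> \<longleftrightarrow> (\<exists>g. orthogonal_matrix g \<and> \<Psi> = g ** \<Omega> ** transpose g)"
  unfolding adjoint_orbit_def mem_Collect_eq
  by (metis orthogonal_matrix_inv_transpose)

lemma adjoint_orbit_refl: "\<Omega> \<in> adjoint_orbit \<Omega>"
  unfolding mem_adjoint_orbit
  by (rule exI[of _ "mat 1"]) (simp add: orthogonal_matrix_id transpose_mat)

lemma adjoint_orbit_subset:
  assumes "\<Psi> \<in> adjoint_orbit \<Omega>"
  shows "adjoint_orbit \<Psi> \<subseteq> adjoint_orbit \<Omega>"
proof
  fix \<Phi> assume "\<Phi> \<in> adjoint_orbit \<Psi>"
  then obtain h where h: "orthogonal_matrix h" "\<Phi> = h ** \<Psi> ** transpose h"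
    unfolding mem_adjoint_orbit by blast
  obtain g where g: "orthogonal_matrix g" "\<Psi> = g ** \<Omega> ** transpose g"
    using assms unfolding mem_adjoint_orbit by blast
  have "\<Phi> = (h ** g) ** \<Omega> ** transpose (h ** g)"
    by (simp add: h g matrix_transpose_mul matrix_mul_assoc)
  then show "\<Phi> \<in> adjoint_orbit \<Omega>"
    unfolding mem_adjoint_orbit using orthogonal_matrix_mul[OF h(1) g(1)] by blast
qed

lemma adjoint_orbit_eq:
  assumes "\<Psi> \<in> adjoint_orbit \<Omega>"
  shows "adjoint_orbit \<Psi> = adjoint_orbit \<Omega>"
proof -
  obtain g where g: "orthogonal_matrix g" "\<Psi> = g ** \<Omega> ** transpose g"
    using assms unfolding mem_adjoint_orbit by blast
  have "transpose g ** g = mat 1" using g(1) by (simp add: orthogonal_matrix)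
  then have "\<Omega> = transpose g ** \<Psi> ** transpose (transpose g)"
    unfolding g(2)
    by (metis matrix_mul_assoc matrix_mul_lid matrix_mul_rid transpose_transpose)
  then have "\<Omega> \<in> adjoint_orbit \<Psi>"
    unfolding mem_adjoint_orbit using g(1) orthogonal_matrix_transpose by blast
  then show ?thesis using adjoint_orbit_subset assms by blast
qed

text \<open>Conjugation preserves the property of squaring to -K. A block form in this orbit
  therefore has every parameter squaring to \<open>K\<close>, and nonnegativity selects the positive
  root, so the description by \<open>THE\<close> is unique.\<close>

lemma orbit_point_block_form:
  assumes K: "0 < K"
  shows "orbit_point (adjoint_orbit (block_form (\<chi> i::'m::{finite,linorder}. sqrt K))) = (\<chi> i. sqrt K)"
  unfolding orbit_point_def
proof (rule the_equality)
  let ?Q = "block_form (\<chi> i::'m. sqrt K)"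
  show "(\<chi> i. sqrt K) \<in> normal_parameters \<and> ?Q \<in> adjoint_orbit ?Q"
    using K adjoint_orbit_refl by (auto simp: normal_parameters_def)
  fix a assume a: "a \<in> normal_parameters \<and> block_form a \<in> adjoint_orbit ?Q"
  then obtain g where g: "orthogonal_matrix g" "block_form a = g ** ?Q ** transpose g"
    unfolding mem_adjoint_orbit by blast
  have gl: "transpose g *v (g *v x) = x" and gr: "g *v (transpose g *v x) = x" for x
    using g(1) unfolding orthogonal_matrix_def
    by (simp_all add: matrix_vector_mul_assoc del: transpose_matrix_vector)
  have "block_form a *v (block_form a *v x) = - (K *\<^sub>R x)" for x
  proof -
    have b: "block_form a *v y = g *v (?Q *v (transpose g *v y))" for y
      by (simp add: g(2) matrix_vector_mul_assoc matrix_mul_assoc del: transpose_matrix_vector)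
    show ?thesis unfolding b gl block_form_square
      using K by (simp add: matrix_vector_mult_minus_right matrix_vector_mult_scaleR gr
          del: transpose_matrix_vector)
  qed
  \<comment> \<open>The first basis vector of block \<open>i\<close> isolates the diagonal entry of
    the square, which is minus the square of \<open>a $ i\<close>.\<close>
  then have "(block_form a *v (block_form a *v axis (i, 1) 1)) $ (i, 1) = - K" for i
    by simp
  then have "a $ i * a $ i = K" for i
    by (simp add: block_form_mult_vec)
  moreover have "0 \<le> a $ i" for i using a by (simp add: normal_parameters_def)
  ultimately have "a $ i = sqrt K" for i
    by (metis real_sqrt_abs2 abs_of_nonneg)
  then show "a = (\<chi> i. sqrt K)" by (simp add: vec_eq_iff)
qed

section \<open>Isometries induced by orthogonal maps\<close>

lemma orthogonal_transformation_sphere_isometry: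
  fixes \<phi> :: "'v::euclidean_space \<Rightarrow> 'v"
  assumes \<phi>: "orthogonal_transformation \<phi>"
  shows "sphere_isometry K \<phi>"
proof -
  have lin: "linear \<phi>" and ip: "\<And>x y. \<phi> x \<bullet> \<phi> y = x \<bullet> y" and nm: "\<And>x. norm (\<phi> x) = norm x"
    using \<phi> by (auto simp: orthogonal_transformation_def orthogonal_transformation_norm)
  have inj: "inj \<phi>" and surj: "surj \<phi>"
    using \<phi> orthogonal_transformation_inj orthogonal_transformation_surj by blast+
  have bij: "bij_betw \<phi> usphere usphere"
    unfolding bij_betw_def
  proof
    show "inj_on \<phi> usphere" using inj inj_on_subset by blast
    show "\<phi> ` usphere = usphere"
    proof
      show "usphere \<subseteq> \<phi> ` usphere"
      proof
        fix y :: 'v assume y: "y \<in> usphere"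
        obtain x where "y = \<phi> x" using surj by (metis surjD)
        then show "y \<in> \<phi> ` usphere" using y nm by auto
      qed
    qed (auto simp: nm)
  qed
  have li: "linear (inv \<phi>)"
    using \<phi> orthogonal_transformation_inv orthogonal_transformation_linear by blast
  \<comment> \<open>On the sphere the inverse agrees with the global linear inverse, which supplies
    its smooth extension.\<close>
  have "the_inv_into usphere \<phi> y = inv \<phi> y" if "y \<in> usphere" for y
  proof (rule the_inv_into_f_eq)
    show "inj_on \<phi> usphere" using bij bij_betw_def by blast
    show "\<phi> (inv \<phi> y) = y" using surj by (simp add: surj_f_inv_f)
    then show "inv \<phi> y \<in> usphere" using that nm[of "inv \<phi> y"] by simp
  qed
  then have "smooth_map_on usphere (the_inv_into usphere \<phi>)"
    using smooth_map_on_linear[OF li, of usphere] unfolding smooth_map_on_def by fastforce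
  then show ?thesis
    using bij lin by (simp add: sphere_isometry_def sphere_diffeo_def smooth_map_on_linear
        sphere_diff_linear h_plus_def ip)
qed

text \<open>Domain and metric are built from inner products of \<open>y\<close> and
  \<open>W p\<close>. These are preserved by \<phi>, which is its own differential on tangent
  vectors and intertwines \<open>W\<close> with \<open>V\<close>.\<close>

lemma conic_isometric_kropina_metric:
  fixes \<phi> :: "'v::euclidean_space \<Rightarrow> 'v"
  assumes \<phi>: "orthogonal_transformation \<phi>" and W: "\<And>p. p \<in> usphere \<Longrightarrow> V (\<phi> p) = \<phi> (W p)"
  shows "conic_isometric (kropina_metric K W) (kropina_metric K V)"
proof -
  have lin: "linear \<phi>" and ip: "\<And>x y. \<phi> x \<bullet> \<phi> y = x \<bullet> y" and nm: "\<And>x. norm (\<phi> x) = norm x"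
    using \<phi> by (auto simp: orthogonal_transformation_def orthogonal_transformation_norm)
  have "sphere_diffeo \<phi>"
    using orthogonal_transformation_sphere_isometry[OF \<phi>] by (auto simp: sphere_isometry_def)
  then show ?thesis
    unfolding conic_isometric_def
    by (intro exI[of _ \<phi>])
      (auto simp: kropina_metric_def kropina_domain_def sphere_diff_linear[OF lin] W ip nm
        h_plus_def tangent_space_def)
qed

theorem theorem7p6:
  fixes K :: real
  assumes "2 \<le> CARD('m::{finite,linorder})" and "0 < K"
  shows
    "moduli_space K = {adjoint_orbit (block_form (\<chi> i::'m. sqrt K))} \<and>
     orbit_point ` moduli_space K = {\<chi> i::'m. sqrt K} \<and>
     (\<exists>W0 :: real ^ ('m \<times> 2) \<Rightarrow> real ^ ('m \<times> 2).
        unit_killing_field K W0 \<and>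
        (\<forall>W. unit_killing_field K W \<longrightarrow>
           (\<exists>\<phi>. sphere_isometry K \<phi> \<and> (\<forall>q\<in>usphere. pushforward \<phi> W q = W0 q))) \<and>
        (\<forall>F\<in>cc_kropina_structures K. conic_isometric F (kropina_metric K W0)))"
proof (intro conjI)
  have K: "0 < K" by fact
  let ?Q = "block_form (\<chi> i::'m. sqrt K)"
  let ?W0 = "\<lambda>p. p v* ?Q"
  have W0: "unit_killing_field K ?W0" by (rule block_form_unit_killing_field[OF K])
  have normal: "\<exists>g. orthogonal_matrix g \<and> g ** \<Omega> ** transpose g = ?Q"
    if "transpose \<Omega> = - \<Omega>" "unit_killing_field K W" "\<forall>p\<in>usphere. W p = p v* \<Omega>" for W \<Omega>
    using conjugate_to_block_form[OF that(1) K]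
      unit_killing_field_matrix[OF that(2) K that(1)] that(3) by metis
  have "adjoint_orbit \<Omega> = adjoint_orbit ?Q" if "\<Omega> \<in> unit_killing_matrices K" for \<Omega>
  proof -
    obtain g where "orthogonal_matrix g" "g ** \<Omega> ** transpose g = ?Q"
      using \<open>\<Omega> \<in> unit_killing_matrices K\<close> normal unfolding unit_killing_matrices_def by blast
    then have "?Q \<in> adjoint_orbit \<Omega>" unfolding mem_adjoint_orbit by metis
    then show ?thesis by (simp add: adjoint_orbit_eq)
  qed
  \<comment> \<open>This makes the moduli space nonempty, so it is exactly one orbit.\<close>
  moreover have "?Q \<in> unit_killing_matrices K"
    unfolding unit_killing_matrices_def using W0 transpose_block_form by blast
  ultimately show "moduli_space K = {adjoint_orbit ?Q}"
    unfolding moduli_space_def by blast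
  then show "orbit_point ` moduli_space K = {\<chi> i::'m. sqrt K}"
    by (simp add: orbit_point_block_form[OF K])
  \<comment> \<open>The conjugating matrix, acting on column vectors, is the isometry carrying
    \<open>W\<close> to the model field.\<close>
  have rot: "\<exists>\<phi>. orthogonal_transformation \<phi> \<and> (\<forall>p\<in>usphere. ?W0 (\<phi> p) = \<phi> (W p))"
    if W: "unit_killing_field K W" for W :: "real ^ ('m \<times> 2) \<Rightarrow> real ^ ('m \<times> 2)"
  proof -
    obtain \<Omega> where \<Omega>: "transpose \<Omega> = - \<Omega>" "\<And>p. p \<in> usphere \<Longrightarrow> W p = p v* \<Omega>"
      using killing_field_matrix W K unfolding unit_killing_field_def by blast
    then obtain g where g: "orthogonal_matrix g" "g ** \<Omega> ** transpose g = ?Q"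
      using normal W by blast
    have gl: "transpose g *v (g *v x) = x" for x
      using g(1) unfolding orthogonal_matrix_def
      by (simp add: matrix_vector_mul_assoc del: transpose_matrix_vector)
    have "?Q *v (g *v p) = g *v (\<Omega> *v p)" for p
    proof -
      have "?Q *v (g *v p) = g *v (\<Omega> *v (transpose g *v (g *v p)))"
        by (simp add: g(2)[symmetric] matrix_vector_mul_assoc matrix_mul_assoc
            del: transpose_matrix_vector)
      then show ?thesis by (simp only: gl)
    qed
    \<comment> \<open>The row convention contributes a minus sign on each side, and the two
      cancel.\<close>
    then have "?W0 (g *v p) = g *v W p" if "p \<in> usphere" for p
      using \<Omega>(2)[OF that] by (simp add: vector_matrix_skew[OF transpose_block_form]
          vector_matrix_skew[OF \<Omega>(1)] matrix_vector_mult_minus_right)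
    moreover have "orthogonal_transformation ((*v) g)"
      using g(1) by (simp add: orthogonal_transformation_matrix)
    ultimately show ?thesis by blast
  qed
  \<comment> \<open>Equivariance under \<phi> is the push-forward equation read at the preimage
    \<open>p\<close> of \<open>q\<close>, since the linear map \<phi> is its own
    differential.\<close>
  have push: "pushforward \<phi> W q = ?W0 q"
    if W: "unit_killing_field K W" and \<phi>: "orthogonal_transformation \<phi>"
      and e: "\<forall>p\<in>usphere. ?W0 (\<phi> p) = \<phi> (W p)" and q: "q \<in> usphere" for W \<phi> q
  proof -
    define p where "p = the_inv_into usphere \<phi> q"
    have "bij_betw \<phi> usphere usphere"
      using orthogonal_transformation_sphere_isometry[OF \<phi>]
      by (auto simp: sphere_isometry_def sphere_diffeo_def)
    then have p: "p \<in> usphere" "\<phi> p = q"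
      using q unfolding p_def
      by (metis bij_betw_def the_inv_into_into subset_refl, metis f_the_inv_into_f_bij_betw)
    moreover have "W p \<in> tangent_space p"
      using W p by (auto simp: unit_killing_field_def killing_field_def sphere_vector_field_def)
    ultimately show ?thesis
      using e \<phi> by (auto simp: pushforward_def Let_def sphere_diff_linear
          orthogonal_transformation_linear simp flip: p_def)
  qed
  show "\<exists>W0 :: real ^ ('m \<times> 2) \<Rightarrow> real ^ ('m \<times> 2).
        unit_killing_field K W0 \<and>
        (\<forall>W. unit_killing_field K W \<longrightarrow>
           (\<exists>\<phi>. sphere_isometry K \<phi> \<and> (\<forall>q\<in>usphere. pushforward \<phi> W q = W0 q))) \<and>
        (\<forall>F\<in>cc_kropina_structures K. conic_isometric F (kropina_metric K W0))"
  proof (rule exI[of _ ?W0], intro conjI allI impI ballI W0)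
    fix W :: "real ^ ('m \<times> 2) \<Rightarrow> real ^ ('m \<times> 2)" assume "unit_killing_field K W"
    then show "\<exists>\<phi>. sphere_isometry K \<phi> \<and> (\<forall>q\<in>usphere. pushforward \<phi> W q = ?W0 q)"
      using rot push orthogonal_transformation_sphere_isometry by metis
  next
    fix F assume "F \<in> (cc_kropina_structures K :: (real ^ ('m \<times> 2)) conic_metric set)"
    then obtain W where "unit_killing_field K W" "F = kropina_metric K W"
      unfolding cc_kropina_structures_def by blast
    then show "conic_isometric F (kropina_metric K ?W0)"
      using rot conic_isometric_kropina_metric by metis
  qed
qed

end
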